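(* Let $\mathcal I$ be an instance of the heterogeneous data-center right-sizing problem and $\gamma>1$. Let $P^\gamma$ be a shortest path from $v^\uparrow_{1,\vec0}$ to $v^\downarrow_{T,\vec0}$ in the graph $G^\gamma$ described below, let $X^\gamma$ be the schedule corresponding to $P^\gamma$, and let $X^\ast$ be an optimal schedule for $\mathcal I$. Then $C(X^\gamma)\le(2\gamma-1)\cdot C(X^\ast)$.
   Context: Notation: $[k]=\{1,\dots,k\}$, $[k]_0=\{0,\dots,k\}$, $(x)^+=\max(x,0)$. Problem: An instance consists of $T\in\mathbb N$ slots, $d\in\mathbb N$ server types, $m_j\in\mathbb N$ servers of type $j$, switching costs $\beta_j>0$, capacities $z^{\max}_j>0$, job volumes $\lambda_t\ge0$, and functions $f_{t,j}$ convex, increasing, non-negative on $[0,z^{\max}_j]$ (value $+\infty$ above $z^{\max}_j$). For $x\in\mathbb N_0$, $z\in[0,1]$: $g_{t,j}(x,z)=xf_{t,j}(\lambda_tz/x)$ if $x>0$, $g_{t,j}(0,z)=\infty$ if $\lambda_tz>0$, $=0$ if $\lambda_tz=0$; $\mathcal Z=\{z\in[0,1]^d:\sum_jz_j=1\}$; $g_t(\vec x)=\min_{z\in\mathcal Z}\sum_jg_{t,j}(x_j,z_j)$. A schedule $X=(\vec x_1,\dots,\vec x_T)$ has $x_{t,j}\in[m_j]_0$, $\vec x_0=\vec x_{T+1}=\vec0$; feasible if $\sum_jx_{t,j}z^{\max}_j\ge\lambda_t$ for all $t$; $C(X)=\sum_{t=1}^T(g_t(\vec x_t)+\sum_j\beta_j(x_{t,j}-x_{t-1,j})^+)$;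 an optimal schedule is a feasible one of minimum cost. Graph $G^\gamma$: let $M^\gamma_j=\{0,m_j\}\cup\{\lfloor\gamma^k\rfloor\in[m_j]_0:k\in\mathbb N\}\cup\{\lceil\gamma^k\rceil\in[m_j]_0:k\in\mathbb N\}$, $\mathcal M^\gamma=M^\gamma_1\times\dots\times M^\gamma_d$, and for $x_j<m_j$ let $N_j(x_j)=\min\{x\in M^\gamma_j:x>x_j\}$. Vertices: $v^\uparrow_{t,\vec x},v^\downarrow_{t,\vec x}$ for $t\in[T]$, $\vec x\in\mathcal M^\gamma$. Edges: $v^\uparrow_{t,\vec x}\to v^\downarrow_{t,\vec x}$ with weight $g_t(\vec x)$; $v^\downarrow_{t,\vec x}\to v^\uparrow_{t+1,\vec x}$ with weight $0$ for $t\in[T-1]$; for each $j$ and each $\vec x\in\mathcal M^\gamma$ with $x_j<m_j$, letting $\vec x'$ be $\vec x$ with $x_j$ replaced by $N_j(x_j)$: an edge $v^\uparrow_{t,\vec x}\to v^\uparrow_{t,\vec x'}$ of weight $\beta_j(N_j(x_j)-x_j)$ and an edge $v^\downarrow_{t,\vec x'}\to v^\downarrow_{t,\vec x}$ of weight $0$. A path from $v^\uparrow_{1,\vec0}$ to $v^\downarrow_{T,\vec0}$ uses exactly one edge of the form $v^\uparrow_{t,\vec x}\to v^\downarrow_{t,\vec x}$ for each $t\in[T]$; the corresponding schedule sets $\vec x_t$ to that $\vec x$. *)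

theory Defs
  imports "HOL-Analysis.Analysis" "Graph_Theory.Arc_Walk"
begin

text \<open>
  The server types are the elements of a finite index type \<^typ>\<open>'d\<close>, so that
  \<open>d = CARD('d)\<close>; a configuration is a function of type \<open>'d \<Rightarrow> nat\<close>.  Time slots are
  \<open>1, \<dots>, slots I\<close>.
\<close>

record 'd dc_instance =
  slots :: nat
  servers :: "'d \<Rightarrow> nat"
  switch_cost :: "'d \<Rightarrow> real"
  capacity :: "'d \<Rightarrow> real"
  volume :: "nat \<Rightarrow> real"
  op_cost :: "nat \<Rightarrow> 'd \<Rightarrow> real \<Rightarrow> real"

definition valid_instance :: "'d::finite dc_instance \<Rightarrow> bool" where
  "valid_instance I \<longleftrightarrow>
     slots I \<ge> 1 \<and>
     (\<forall>j. servers I j \<ge> 1 \<and> switch_cost I j > 0 \<and> capacity I j > 0) \<and>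
     (\<forall>t\<in>{1..slots I}. volume I t \<ge> 0) \<and>
     (\<forall>t\<in>{1..slots I}. \<forall>j.
        convex_on {0..capacity I j} (op_cost I t j) \<and>
        mono_on {0..capacity I j} (op_cost I t j) \<and>
        (\<forall>y\<in>{0..capacity I j}. op_cost I t j y \<ge> 0))"

text \<open>
  The field \<^const>\<open>op_cost\<close> only matters on \<open>[0, capacity I j]\<close>; the cost function
  \<open>f\<^sub>t\<^sub>,\<^sub>j\<close> proper is its extension by \<open>\<infinity>\<close> above the capacity.
\<close>

definition op_cost_ext :: "'d::finite dc_instance \<Rightarrow> nat \<Rightarrow> 'd \<Rightarrow> real \<Rightarrow> ereal" where
  "op_cost_ext I t j y = (if y \<le> capacity I j then ereal (op_cost I t j y) else \<infinity>)"

definition type_cost :: "'d::finite dc_instance \<Rightarrow> nat \<Rightarrow> 'd \<Rightarrow> nat \<Rightarrow> real \<Rightarrow> ereal" where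
  "type_cost I t j x z =
     (if x > 0 then ereal (real x) * op_cost_ext I t j (volume I t * z / real x)
      else if volume I t * z > 0 then \<infinity> else 0)"

definition splits :: "('d::finite \<Rightarrow> real) set" where
  "splits = {z. (\<forall>j. z j \<in> {0..1}) \<and> (\<Sum>j\<in>UNIV. z j) = 1}"

text \<open>
  The minimum over all job splits is taken as an infimum: if some \<open>f\<^sub>t\<^sub>,\<^sub>j\<close> jumps at its
  capacity (which convexity on the closed interval allows), it need not be attained.
\<close>

definition slot_cost :: "'d::finite dc_instance \<Rightarrow> nat \<Rightarrow> ('d \<Rightarrow> nat) \<Rightarrow> ereal" where
  "slot_cost I t x = (INF z\<in>splits. \<Sum>j\<in>UNIV. type_cost I t j (x j) (z j))"

definition is_schedule :: "'d::finite dc_instance \<Rightarrow> (nat \<Rightarrow> 'd \<Rightarrow> nat) \<Rightarrow> bool" where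
  "is_schedule I X \<longleftrightarrow>
     (\<forall>t\<in>{1..slots I}. \<forall>j. X t j \<le> servers I j) \<and>
     X 0 = (\<lambda>_. 0) \<and> X (slots I + 1) = (\<lambda>_. 0)"

definition feasible :: "'d::finite dc_instance \<Rightarrow> (nat \<Rightarrow> 'd \<Rightarrow> nat) \<Rightarrow> bool" where
  "feasible I X \<longleftrightarrow>
     is_schedule I X \<and>
     (\<forall>t\<in>{1..slots I}. (\<Sum>j\<in>UNIV. real (X t j) * capacity I j) \<ge> volume I t)"

definition schedule_cost :: "'d::finite dc_instance \<Rightarrow> (nat \<Rightarrow> 'd \<Rightarrow> nat) \<Rightarrow> ereal" where
  "schedule_cost I X =
     (\<Sum>t=1..slots I. slot_cost I t (X t) +
        ereal (\<Sum>j\<in>UNIV. switch_cost I j * max (real (X t j) - real (X (t - 1) j)) 0))"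

definition optimal :: "'d::finite dc_instance \<Rightarrow> (nat \<Rightarrow> 'd \<Rightarrow> nat) \<Rightarrow> bool" where
  "optimal I X \<longleftrightarrow>
     feasible I X \<and> (\<forall>Y. feasible I Y \<longrightarrow> schedule_cost I X \<le> schedule_cost I Y)"

definition grid :: "'d::finite dc_instance \<Rightarrow> real \<Rightarrow> 'd \<Rightarrow> nat set" where
  "grid I \<gamma> j =
     {0, servers I j}
     \<union> {nat \<lfloor>\<gamma> ^ k\<rfloor> | k. k \<ge> 1 \<and> nat \<lfloor>\<gamma> ^ k\<rfloor> \<le> servers I j}
     \<union> {nat \<lceil>\<gamma> ^ k\<rceil> | k. k \<ge> 1 \<and> nat \<lceil>\<gamma> ^ k\<rceil> \<le> servers I j}"

definition grid_configs :: "'d::finite dc_instance \<Rightarrow> real \<Rightarrow> ('d \<Rightarrow> nat) set" where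
  "grid_configs I \<gamma> = {x. \<forall>j. x j \<in> grid I \<gamma> j}"

definition next_grid :: "'d::finite dc_instance \<Rightarrow> real \<Rightarrow> 'd \<Rightarrow> nat \<Rightarrow> nat" where
  "next_grid I \<gamma> j y = Min {x \<in> grid I \<gamma> j. x > y}"

definition raise :: "'d::finite dc_instance \<Rightarrow> real \<Rightarrow> 'd \<Rightarrow> ('d \<Rightarrow> nat) \<Rightarrow> 'd \<Rightarrow> nat" where
  "raise I \<gamma> j x = x(j := next_grid I \<gamma> j (x j))"

datatype 'd vertex = Up nat "'d \<Rightarrow> nat" | Down nat "'d \<Rightarrow> nat"

text \<open>
  Both \<open>PowerUp t x j\<close> and \<open>PowerDown t x j\<close> are labelled by the smaller configuration \<open>x\<close>.
\<close>

datatype 'd edge =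
    Operate nat "'d \<Rightarrow> nat"
  | Advance nat "'d \<Rightarrow> nat"
  | PowerUp nat "'d \<Rightarrow> nat" 'd
  | PowerDown nat "'d \<Rightarrow> nat" 'd

fun edge_tail :: "'d::finite dc_instance \<Rightarrow> real \<Rightarrow> 'd edge \<Rightarrow> 'd vertex" where
  "edge_tail I \<gamma> (Operate t x) = Up t x"
| "edge_tail I \<gamma> (Advance t x) = Down t x"
| "edge_tail I \<gamma> (PowerUp t x j) = Up t x"
| "edge_tail I \<gamma> (PowerDown t x j) = Down t (raise I \<gamma> j x)"

fun edge_head :: "'d::finite dc_instance \<Rightarrow> real \<Rightarrow> 'd edge \<Rightarrow> 'd vertex" where
  "edge_head I \<gamma> (Operate t x) = Down t x"
| "edge_head I \<gamma> (Advance t x) = Up (t + 1) x"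
| "edge_head I \<gamma> (PowerUp t x j) = Up t (raise I \<gamma> j x)"
| "edge_head I \<gamma> (PowerDown t x j) = Down t x"

fun edge_weight :: "'d::finite dc_instance \<Rightarrow> real \<Rightarrow> 'd edge \<Rightarrow> ereal" where
  "edge_weight I \<gamma> (Operate t x) = slot_cost I t x"
| "edge_weight I \<gamma> (Advance t x) = 0"
| "edge_weight I \<gamma> (PowerUp t x j) =
     ereal (switch_cost I j * (real (next_grid I \<gamma> j (x j)) - real (x j)))"
| "edge_weight I \<gamma> (PowerDown t x j) = 0"

definition sched_graph ::
    "'d::finite dc_instance \<Rightarrow> real \<Rightarrow> ('d vertex, 'd edge) pre_digraph" where
  "sched_graph I \<gamma> =
     \<lparr> verts = {Up t x | t x. t \<in> {1..slots I} \<and> x \<in> grid_configs I \<gamma>}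
             \<union> {Down t x | t x. t \<in> {1..slots I} \<and> x \<in> grid_configs I \<gamma>},
       arcs = {Operate t x | t x. t \<in> {1..slots I} \<and> x \<in> grid_configs I \<gamma>}
            \<union> {Advance t x | t x. t \<in> {1..slots I - 1} \<and> x \<in> grid_configs I \<gamma>}
            \<union> {PowerUp t x j | t x j.
                 t \<in> {1..slots I} \<and> x \<in> grid_configs I \<gamma> \<and> x j < servers I j}
            \<union> {PowerDown t x j | t x j.
                 t \<in> {1..slots I} \<and> x \<in> grid_configs I \<gamma> \<and> x j < servers I j},
       tail = edge_tail I \<gamma>,
       head = edge_head I \<gamma> \<rparr>"

definition path_weight :: "'d::finite dc_instance \<Rightarrow> real \<Rightarrow> 'd edge list \<Rightarrow> ereal" where
  "path_weight I \<gamma> p = (\<Sum>e\<leftarrow>p. edge_weight I \<gamma> e)"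

definition shortest_path ::
    "'d::finite dc_instance \<Rightarrow> real \<Rightarrow> 'd vertex \<Rightarrow> 'd edge list \<Rightarrow> 'd vertex \<Rightarrow> bool" where
  "shortest_path I \<gamma> u p v \<longleftrightarrow>
     pre_digraph.apath (sched_graph I \<gamma>) u p v \<and>
     (\<forall>q. pre_digraph.apath (sched_graph I \<gamma>) u q v \<longrightarrow>
        path_weight I \<gamma> p \<le> path_weight I \<gamma> q)"

definition path_schedule ::
    "'d::finite dc_instance \<Rightarrow> 'd edge list \<Rightarrow> nat \<Rightarrow> 'd \<Rightarrow> nat" where
  "path_schedule I p t =
     (if t \<in> {1..slots I} then THE x. Operate t x \<in> set p else (\<lambda>_. 0))"

end

theory Submission
  imports Defs
begin

text \<open>
  Put \<open>c = 2\<gamma> - 1\<close>. A path in the graph costs at least as much as its schedule,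
  and every schedule on the grid is described by a path of at most its cost; so it suffices to round
  an optimal schedule to a grid schedule of at most \<open>c\<close> times its cost. Round each
  server type separately and lazily: with \<open>a\<close> the number of active servers in the
  optimal schedule, keep the rounded number \<open>b\<close> while \<open>a \<le> b \<le> c
  a\<close>; otherwise move it to the nearest grid point of that interval. Since \<open>a \<le> b
  \<le> c a\<close> always holds, monotonicity of the cost functions bounds the operating cost. The
  switching cost is amortised by the potential \<open>\<Phi>(a, b) = max 0 (c (a - 1) - \<gamma>
  b)\<close>: in every step, the increase of \<open>b\<close> plus the change of
  \<open>\<Phi>\<close> is at most \<open>c\<close> times the increase of \<open>a\<close>.
\<close>

section \<open>The grid\<close>

lemma finite_grid: "finite (grid I \<gamma> j)"
  by (rule finite_subset[of _ "{..servers I j}"]) (auto simp: grid_def)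

lemma grid_le_servers: "y \<in> grid I \<gamma> j \<Longrightarrow> y \<le> servers I j"
  by (auto simp: grid_def)

lemma zero_in_grid: "0 \<in> grid I \<gamma> j"
  and servers_in_grid: "servers I j \<in> grid I \<gamma> j"
  by (auto simp: grid_def)

lemma next_grid:
  assumes "y < servers I j"
  shows next_grid_in_grid: "next_grid I \<gamma> j y \<in> grid I \<gamma> j"
    and next_grid_greater: "y < next_grid I \<gamma> j y"
    and next_grid_least: "x \<in> grid I \<gamma> j \<Longrightarrow> y < x \<Longrightarrow> next_grid I \<gamma> j y \<le> x"
proof -
  have "next_grid I \<gamma> j y \<in> {x \<in> grid I \<gamma> j. x > y}"
    unfolding next_grid_def using assms servers_in_grid finite_grid[of I \<gamma> j]
    by (intro Min_in) auto
  then show "next_grid I \<gamma> j y \<in> grid I \<gamma> j" "y < next_grid I \<gamma> j y"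
    by auto
  show "x \<in> grid I \<gamma> j \<Longrightarrow> y < x \<Longrightarrow> next_grid I \<gamma> j y \<le> x"
    unfolding next_grid_def using finite_grid[of I \<gamma> j] by (intro Min_le) auto
qed

lemma floor_power_in_grid:
  "k \<ge> 1 \<Longrightarrow> nat \<lfloor>\<gamma> ^ k\<rfloor> \<le> servers I j \<Longrightarrow> nat \<lfloor>\<gamma> ^ k\<rfloor> \<in> grid I \<gamma> j"
  and ceiling_power_in_grid:
  "k \<ge> 1 \<Longrightarrow> nat \<lceil>\<gamma> ^ k\<rceil> \<le> servers I j \<Longrightarrow> nat \<lceil>\<gamma> ^ k\<rceil> \<in> grid I \<gamma> j"
  by (auto simp: grid_def)

text \<open>
  The unit gap in the second alternative is the one between \<open>\<lfloor>\<gamma>\<^sup>k\<rfloor>\<close> and \<open>\<lceil>\<gamma>\<^sup>k\<rceil>\<close>; it need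
  not satisfy the first alternative.  This is why the grid contains both roundings.
\<close>

lemma next_grid_gap:
  assumes "\<gamma> > 1" and "y < servers I j"
  shows "real (next_grid I \<gamma> j y) \<le> \<gamma> * real (max y 1) \<or> next_grid I \<gamma> j y = y + 1"
proof (cases "real (servers I j) \<le> \<gamma> * real (max y 1)")
  case True
  have "next_grid I \<gamma> j y \<le> servers I j"
    using next_grid_in_grid[OF assms(2)] grid_le_servers by blast
  then show ?thesis using True by linarith
next
  case False
  obtain n where n: "real y < \<gamma> ^ n"
    using real_arch_pow[OF assms(1)] by blast
  \<comment> \<open>\<open>Suc n\<close> keeps the exponent positive, as the grid requires. For
    \<open>k = 0\<close> the preceding power is 1, which is why the bound uses
    \<open>max y 1\<close> instead of \<open>y\<close>.\<close>
  define k where "k = (LEAST n. real y < \<gamma> ^ Suc n)"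
  have "real y < \<gamma> ^ Suc n"
    using n assms(1) by (smt (verit) power_strict_increasing_iff lessI)
  then have k: "real y < \<gamma> ^ Suc k"
    unfolding k_def by (rule LeastI)
  have upper: "\<gamma> ^ k \<le> real (max y 1)"
  proof (cases k)
    case (Suc i)
    then have "\<not> real y < \<gamma> ^ Suc i"
      using not_less_Least[of i "\<lambda>n. real y < \<gamma> ^ Suc n"] k_def by simp
    then show ?thesis using Suc by simp
  qed simp
  have le: "\<gamma> ^ Suc k \<le> \<gamma> * real (max y 1)"
    using upper assms(1) by simp
  have pos: "0 < \<gamma> ^ Suc k" using assms(1) by simp
  define p where "p = nat \<lfloor>\<gamma> ^ Suc k\<rfloor>"
  have p_le: "real p \<le> \<gamma> ^ Suc k"
    unfolding p_def using pos by linarith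
  have p_ge: "y \<le> p"
    unfolding p_def using k by linarith
  show ?thesis
  proof (cases "y < p")
    case True
    have "p \<le> servers I j" using p_le le False by linarith
    then have "p \<in> grid I \<gamma> j"
      unfolding p_def by (intro floor_power_in_grid) auto
    then have "next_grid I \<gamma> j y \<le> p"
      using next_grid_least[OF assms(2)] True by blast
    then show ?thesis using p_le le by linarith
  next
    case False
    \<comment> \<open>The power lies strictly above \<open>y\<close> and has floor \<open>y\<close>,
      so it is not an integer and its ceiling is \<open>y + 1\<close>.\<close>
    then have "nat \<lfloor>\<gamma> ^ Suc k\<rfloor> = y" using p_ge p_def by simp
    then have c: "nat \<lceil>\<gamma> ^ Suc k\<rceil> = y + 1"
      using k pos by linarith
    then have "y + 1 \<in> grid I \<gamma> j"
      using ceiling_power_in_grid[of "Suc k" \<gamma> I j] assms(2) by simp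
    then have "next_grid I \<gamma> j y \<le> y + 1"
      using next_grid_least[OF assms(2)] by simp
    then show ?thesis
      using next_grid_greater[OF assms(2), of \<gamma>] by linarith
  qed
qed

section \<open>Rounding a schedule to the grid\<close>

text \<open>While \<open>b\<close> is kept, growth of \<open>a\<close> is saved here, to be spent
  when \<open>b\<close> has to jump. The shift to \<open>a - 1\<close> absorbs the unit gaps of the
  grid, so that the potential vanishes after every downward move.\<close>

definition potential :: "real \<Rightarrow> nat \<Rightarrow> nat \<Rightarrow> real" where
  "potential \<gamma> a b = max 0 ((2 * \<gamma> - 1) * (real a - 1) - \<gamma> * real b)"

text \<open>Counting from \<open>a - 1\<close> yields the least grid point that is at least
  \<open>a\<close>. Hence there is always a grid point between \<open>a\<close> and
  \<open>\<gamma> * a\<close>, so the target interval of the rounding is never empty.\<close>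

lemma next_grid_pred_le:
  assumes "\<gamma> > 1" and "1 \<le> a" and "a \<le> servers I j"
  shows "real (next_grid I \<gamma> j (a - 1)) \<le> \<gamma> * real a"
proof -
  have lt: "a - 1 < servers I j" using assms by linarith
  have "\<gamma> * real (max (a - 1) 1) \<le> \<gamma> * real a"
    using assms by (intro mult_left_mono) auto
  moreover have "real a \<le> \<gamma> * real a"
    using assms by (simp add: mult_le_cancel_right1)
  ultimately show ?thesis
    using next_grid_gap[OF assms(1) lt] assms(2) by (elim disjE) linarith+
qed

lemma rounding_step:
  assumes \<gamma>: "\<gamma> > 1"
    and b: "b \<in> grid I \<gamma> j" "a \<le> b" "real b \<le> (2 * \<gamma> - 1) * real a"
    and a': "a' \<le> servers I j"
  shows "\<exists>b' \<in> grid I \<gamma> j. a' \<le> b' \<and> real b' \<le> (2 * \<gamma> - 1) * real a' \<and>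
           max (real b' - real b) 0 + potential \<gamma> a' b' \<le>
           (2 * \<gamma> - 1) * max (real a' - real a) 0 + potential \<gamma> a b"
proof -
  let ?c = "2 * \<gamma> - 1"
  consider (keep) "a' \<le> b" "real b \<le> ?c * real a'" | (up) "b < a'" | (down) "?c * real a' < real b"
    by linarith
  then show ?thesis
  proof cases
    case keep
    \<comment> \<open>Only the potential changes here. It has slope at most
      \<open>2 * \<gamma> - 1\<close> in \<open>a\<close>, so it grows by at most the
      allowance.\<close>
    have "?c * (real a' - real a) \<le> ?c * max (real a' - real a) 0"
      "0 \<le> ?c * max (real a' - real a) 0"
      using \<gamma> by (auto intro!: mult_left_mono mult_nonneg_nonneg)
    moreover have "?c * (real a' - 1) = ?c * (real a - 1) + ?c * (real a' - real a)"
      by (simp add: algebra_simps)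
    ultimately have "potential \<gamma> a' b \<le> ?c * max (real a' - real a) 0 + potential \<gamma> a b"
      unfolding potential_def by linarith
    with keep b show ?thesis by (intro bexI[of _ b]) auto
  next
    case up
    define q where "q = next_grid I \<gamma> j (a' - 1)"
    have lt: "a' - 1 < servers I j" using up a' by linarith
    have q: "q \<in> grid I \<gamma> j" "a' \<le> q"
      using next_grid_in_grid[OF lt, of \<gamma>] next_grid_greater[OF lt, of \<gamma>]
      unfolding q_def by linarith+
    have "real q \<le> \<gamma> * real a'"
      unfolding q_def using up a' \<gamma> by (intro next_grid_pred_le) auto
    also have "\<dots> \<le> ?c * real a'" using \<gamma> by (intro mult_right_mono) auto
    finally have q_le: "real q \<le> ?c * real a'" .
    have gap: "real q \<le> \<gamma> * real (max (a' - 1) 1) \<or> q = a'"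
      using next_grid_gap[OF \<gamma> lt] up unfolding q_def by auto
    \<comment> \<open>The two alternatives of the maximum in \<open>potential \<gamma> a' q\<close>
      are bounded separately. \<open>grow\<close> is the positive one: raising \<open>b\<close> to
      \<open>q\<close> lowers the potential at rate \<open>\<gamma> > 1\<close>, which outweighs the
      cost \<open>q - b\<close>. The next inequality covers the case where the potential is
      0.\<close>
    have "(\<gamma> - 1) * real b \<le> (\<gamma> - 1) * real q"
      using up q \<gamma> by (intro mult_left_mono) auto
    then have grow: "?c * (real a' - 1) - \<gamma> * real q + (real q - real b)
        \<le> ?c * (real a' - real a) + (?c * (real a - 1) - \<gamma> * real b)"
      by (simp add: algebra_simps)
    have "real q - real b \<le> ?c * (real a' - real a) + potential \<gamma> a b"
    proof -
      \<comment> \<open>\<open>a' = 1\<close> is separate because \<open>max (a' - 1) 1\<close> is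
        then not \<open>a' - 1\<close>; in that case \<open>a\<close> and \<open>b\<close> are both
        0 and the allowance alone suffices.\<close>
      consider "q = a'" | "a' = 1" | "a' \<ge> 2" "real q \<le> \<gamma> * (real a' - 1)"
      proof (cases "a' \<ge> 2")
        case True
        then have "real (max (a' - 1) 1) = real a' - 1" by (simp add: max_absorb1)
        then show thesis using gap True that by auto
      qed (use up that in linarith)
      then show ?thesis
      proof cases
        case 1
        have "1 * (real a' - real a) \<le> ?c * (real a' - real a)"
          using up b \<gamma> by (intro mult_right_mono) auto
        then show ?thesis using 1 b by (simp add: potential_def)
      next
        case 2
        then have "b = 0" "a = 0" using up b by auto
        then show ?thesis using 2 q_le by (simp add: potential_def)
      next
        case 3
        \<comment> \<open>Here the savings are spent: allowance and potential together reach
          \<open>(2 * \<gamma> - 1) * (a' - 1) - \<gamma> * b\<close>, and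
          \<open>b \<le> a' - 1\<close> makes this enough to move up to
          \<open>\<gamma> * (a' - 1)\<close>.\<close>
        have "(\<gamma> - 1) * real b \<le> (\<gamma> - 1) * (real a' - 1)"
          using up \<gamma> by (intro mult_left_mono) auto
        then have "real q - real b \<le> ?c * (real a' - 1) - \<gamma> * real b"
          using 3 by (simp add: algebra_simps)
        then show ?thesis by (simp add: potential_def algebra_simps)
      qed
    qed
    then have "real q - real b + potential \<gamma> a' q \<le> ?c * (real a' - real a) + potential \<gamma> a b"
      using grow unfolding potential_def by (auto simp: max_def)
    then show ?thesis using q q_le up b by (intro bexI[of _ q]) auto
  next
    case down
    \<comment> \<open>The target is the largest grid point satisfying the upper bound. Its
      maximality forces the next grid point above \<open>(2 * \<gamma> - 1) * a'\<close>.\<close>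
    define S where "S = {x \<in> grid I \<gamma> j. real x \<le> ?c * real a'}"
    define p where "p = Max S"
    have S: "finite S" "0 \<in> S"
      using finite_grid[of I \<gamma> j] zero_in_grid[of I \<gamma> j] \<gamma> by (auto simp: S_def)
    then have "p \<in> S" unfolding p_def by (intro Max_in) auto
    then have p: "p \<in> grid I \<gamma> j" "real p \<le> ?c * real a'" by (auto simp: S_def)
    have p_max: "x \<le> p" if "x \<in> S" for x
      unfolding p_def using S that by simp
    have "p < b" using p down by linarith
    then have lt: "p < servers I j" using b grid_le_servers by (meson less_le_trans)
    let ?q = "next_grid I \<gamma> j p"
    have q: "?q \<in> grid I \<gamma> j" "p < ?q"
      using next_grid_in_grid[OF lt] next_grid_greater[OF lt] by auto
    have q_gt: "?c * real a' < real ?q"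
      using p_max[of ?q] q unfolding S_def by fastforce
    have "a' \<le> p"
    proof (cases "a' = 0")
      case False
      have lt': "a' - 1 < servers I j" using False a' by linarith
      let ?r = "next_grid I \<gamma> j (a' - 1)"
      have "real ?r \<le> \<gamma> * real a'"
        using False a' \<gamma> by (intro next_grid_pred_le) auto
      also have "\<dots> \<le> ?c * real a'" using \<gamma> by (intro mult_right_mono) auto
      finally have "?r \<in> S" unfolding S_def using next_grid_in_grid[OF lt'] by simp
      then show ?thesis using p_max next_grid_greater[OF lt', of \<gamma>] by fastforce
    qed simp
    \<comment> \<open>This empties the potential. If the next grid point is at most
      \<open>\<gamma> * p\<close>, the bound is immediate; if it is \<open>p + 1\<close>, the shift
      subtracts \<open>2 * \<gamma> - 1 > 1\<close> and so compensates for the unit.\<close>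
    have "?c * (real a' - 1) \<le> \<gamma> * real p"
    proof (cases "a' = 0")
      case True
      have "0 \<le> \<gamma> * real p" using \<gamma> by simp
      moreover have "?c * (real a' - 1) \<le> 0" using True \<gamma> by simp
      ultimately show ?thesis by linarith
    next
      case False
      then have "p \<ge> 1" using \<open>a' \<le> p\<close> by linarith
      have "1 * real p \<le> \<gamma> * real p" using \<gamma> by (intro mult_right_mono) auto
      moreover have "?c * (real a' - 1) = ?c * real a' - ?c" by (simp add: algebra_simps)
      moreover have "max p 1 = p" using \<open>p \<ge> 1\<close> by simp
      moreover have "real ?q \<le> \<gamma> * real (max p 1) \<or> real ?q = real p + 1"
        using next_grid_gap[OF \<gamma> lt] by auto
      ultimately show ?thesis using q_gt \<gamma> by (elim disjE) linarith+
    qed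
    then have "potential \<gamma> a' p = 0" by (simp add: potential_def)
    moreover have "0 \<le> ?c * max (real a' - real a) 0" "0 \<le> potential \<gamma> a b"
      using \<gamma> by (auto simp: potential_def)
    ultimately show ?thesis
      using p \<open>a' \<le> p\<close> \<open>p < b\<close> by (intro bexI[of _ p]) auto
  qed
qed

text \<open>Dependent choice iterates \<open>rounding_step\<close>. Summation telescopes the
  potential, which starts at 0 and is never negative, so it drops out of the bound for every
  prefix.\<close>

lemma rounding_exists:
  fixes a :: "nat \<Rightarrow> nat"
  assumes \<gamma>: "\<gamma> > 1" and a0: "a 0 = 0" and a: "\<And>t. a t \<le> servers I j"
  shows "\<exists>b. (\<forall>t. b t \<in> grid I \<gamma> j \<and> a t \<le> b t \<and> real (b t) \<le> (2 * \<gamma> - 1) * real (a t)) \<and>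
    (\<forall>n. (\<Sum>t=1..n. max (real (b t) - real (b (t - 1))) 0) \<le>
         (2 * \<gamma> - 1) * (\<Sum>t=1..n. max (real (a t) - real (a (t - 1))) 0))"
proof -
  let ?c = "2 * \<gamma> - 1"
  have "\<exists>b. \<forall>t. (b t \<in> grid I \<gamma> j \<and> a t \<le> b t \<and> real (b t) \<le> ?c * real (a t)) \<and>
    max (real (b (Suc t)) - real (b t)) 0 + potential \<gamma> (a (Suc t)) (b (Suc t)) \<le>
      ?c * max (real (a (Suc t)) - real (a t)) 0 + potential \<gamma> (a t) (b t)"
  proof (rule dependent_nat_choice)
    show "\<exists>b. b \<in> grid I \<gamma> j \<and> a 0 \<le> b \<and> real b \<le> ?c * real (a 0)"
      using zero_in_grid a0 by (intro exI[of _ 0]) auto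
  next
    fix b t assume "b \<in> grid I \<gamma> j \<and> a t \<le> b \<and> real b \<le> ?c * real (a t)"
    then show "\<exists>b'. (b' \<in> grid I \<gamma> j \<and> a (Suc t) \<le> b' \<and> real b' \<le> ?c * real (a (Suc t))) \<and>
      max (real b' - real b) 0 + potential \<gamma> (a (Suc t)) b' \<le>
      ?c * max (real (a (Suc t)) - real (a t)) 0 + potential \<gamma> (a t) b"
      using rounding_step[OF \<gamma>, of b I j "a t" "a (Suc t)"] a[of "Suc t"] by blast
  qed
  then obtain b where b: "\<And>t. b t \<in> grid I \<gamma> j \<and> a t \<le> b t \<and> real (b t) \<le> ?c * real (a t)"
    and step: "\<And>t. max (real (b (Suc t)) - real (b t)) 0 + potential \<gamma> (a (Suc t)) (b (Suc t)) \<le>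
      ?c * max (real (a (Suc t)) - real (a t)) 0 + potential \<gamma> (a t) (b t)"
    by blast
  have "(\<Sum>t=1..n. max (real (b t) - real (b (t - 1))) 0) + potential \<gamma> (a n) (b n) \<le>
      ?c * (\<Sum>t=1..n. max (real (a t) - real (a (t - 1))) 0)" for n
  proof (induction n)
    case 0
    then show ?case using a0 b[of 0] \<gamma> by (simp add: potential_def)
  next
    case (Suc n)
    then show ?case using step[of n] by (simp add: distrib_left)
  qed
  moreover have "0 \<le> potential \<gamma> (a n) (b n)" for n by (simp add: potential_def)
  ultimately show ?thesis using b by (intro exI[of _ b]) (smt (verit))
qed

section \<open>Operating and switching costs\<close>

lemma valid_instanceD:
  assumes "valid_instance I"
  shows "slots I \<ge> 1" "switch_cost I j > 0"
    and "t \<in> {1..slots I} \<Longrightarrow> volume I t \<ge> 0"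
    and "t \<in> {1..slots I} \<Longrightarrow> mono_on {0..capacity I j} (op_cost I t j)"
    and "t \<in> {1..slots I} \<Longrightarrow> y \<in> {0..capacity I j} \<Longrightarrow> op_cost I t j y \<ge> 0"
  using assms unfolding valid_instance_def by auto

lemma type_cost_nonneg:
  assumes "valid_instance I" and "t \<in> {1..slots I}" and "0 \<le> z"
  shows "0 \<le> type_cost I t j x z"
  using valid_instanceD(3,5)[OF assms(1,2)] assms(3)
  by (auto simp: type_cost_def op_cost_ext_def)

lemma slot_cost_nonneg:
  assumes "valid_instance I" and "t \<in> {1..slots I}"
  shows "0 \<le> slot_cost I t x"
  unfolding slot_cost_def
  by (intro INF_greatest sum_nonneg type_cost_nonneg[OF assms]) (auto simp: splits_def)

text \<open>Spreading the same volume over more servers lowers the load and, by monotonicity, the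
  cost per server; the number of servers grows by at most the factor \<open>c\<close>. If
  \<open>x = 0\<close>, then \<open>y = 0\<close> as well.\<close>

lemma type_cost_scale:
  assumes I: "valid_instance I" and t: "t \<in> {1..slots I}" and z: "0 \<le> z"
    and c: "c > 0" and x: "x \<le> y" "real y \<le> c * real x"
  shows "type_cost I t j y z \<le> ereal c * type_cost I t j x z"
proof (cases "x = 0")
  case True
  then show ?thesis using x c by (auto simp: type_cost_def)
next
  case False
  let ?u = "volume I t * z / real x" and ?v = "volume I t * z / real y"
  have vol: "0 \<le> volume I t * z"
    using valid_instanceD(3)[OF I t] z by simp
  have uv: "?v \<le> ?u" "0 \<le> ?v"
    using False x vol by (auto intro!: divide_left_mono)
  show ?thesis
  proof (cases "?u \<le> capacity I j")
    case True
    have "op_cost I t j ?v \<le> op_cost I t j ?u"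
      using uv True by (intro mono_onD[OF valid_instanceD(4)[OF I t]]) auto
    moreover have "0 \<le> op_cost I t j ?u"
      using uv True by (intro valid_instanceD(5)[OF I t]) auto
    ultimately have "real y * op_cost I t j ?v \<le> c * real x * op_cost I t j ?u"
      using x c by (meson mult_left_mono mult_right_mono of_nat_0_le_iff order_trans)
    then show ?thesis
      using True uv False x by (auto simp: type_cost_def op_cost_ext_def mult.assoc)
  next
    case inf: False
    then show ?thesis
      using False c by (auto simp: type_cost_def op_cost_ext_def)
  qed
qed

lemma slot_cost_scale:
  assumes I: "valid_instance I" and t: "t \<in> {1..slots I}" and c: "c > 0"
    and x: "\<And>j. x j \<le> y j" "\<And>j. real (y j) \<le> c * real (x j)"
  shows "slot_cost I t y \<le> ereal c * slot_cost I t x"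
proof -
  \<comment> \<open>The factor is moved to the left so that \<open>INF_greatest\<close> applies. The
    same split \<open>z\<close> serves both configurations.\<close>
  have "slot_cost I t y / ereal c \<le> (\<Sum>j\<in>UNIV. type_cost I t j (x j) (z j))" if z: "z \<in> splits" for z
  proof -
    have z0: "0 \<le> z j" for j using z by (auto simp: splits_def)
    have "slot_cost I t y \<le> (\<Sum>j\<in>UNIV. type_cost I t j (y j) (z j))"
      unfolding slot_cost_def using z by (rule INF_lower)
    also have "\<dots> \<le> (\<Sum>j\<in>UNIV. ereal c * type_cost I t j (x j) (z j))"
      by (intro sum_mono type_cost_scale[OF I t z0 c x])
    also have "\<dots> = ereal c * (\<Sum>j\<in>UNIV. type_cost I t j (x j) (z j))"
      using type_cost_nonneg[OF I t z0] by (intro sum_ereal_right_distrib[symmetric])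
    finally show ?thesis using c by (simp add: ereal_divide_le_pos)
  qed
  then have "slot_cost I t y / ereal c \<le> slot_cost I t x"
    unfolding slot_cost_def[of I t x] by (rule INF_greatest)
  then show ?thesis using c by (simp add: ereal_divide_le_pos)
qed

section \<open>Switching costs between configurations\<close>

definition switching :: "'d::finite dc_instance \<Rightarrow> ('d \<Rightarrow> nat) \<Rightarrow> ('d \<Rightarrow> nat) \<Rightarrow> real" where
  "switching I x y = (\<Sum>j\<in>UNIV. switch_cost I j * max (real (y j) - real (x j)) 0)"

lemma schedule_cost_switching:
  "schedule_cost I X = (\<Sum>t=1..slots I. slot_cost I t (X t) + ereal (switching I (X (t - 1)) (X t)))"
  by (simp add: schedule_cost_def switching_def)

lemma switching_nonneg: "valid_instance I \<Longrightarrow> 0 \<le> switching I x y"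
  unfolding switching_def using valid_instanceD(2)
  by (intro sum_nonneg mult_nonneg_nonneg) (auto intro: less_imp_le)

lemma switching_triangle:
  assumes "valid_instance I"
  shows "switching I x z \<le> switching I x y + switching I y z"
  unfolding switching_def sum.distrib[symmetric] distrib_left[symmetric]
  using valid_instanceD(2)[OF assms]
  by (intro sum_mono mult_left_mono) (auto intro: less_imp_le)

lemma switching_decrease:
  assumes "\<And>j. y j \<le> x j"
  shows "switching I x y = 0"
  unfolding switching_def by (intro sum.neutral) (use assms in auto)

lemma switching_add:
  assumes "\<And>j. x j \<le> y j" "\<And>j. y j \<le> z j"
  shows "switching I x z = switching I x y + switching I y z"
proof -
  have "max (real (z j) - real (x j)) 0 =
      max (real (y j) - real (x j)) 0 + max (real (z j) - real (y j)) 0" for j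
    using assms(1)[of j] assms(2)[of j] by auto
  then show ?thesis
    unfolding switching_def sum.distrib[symmetric] distrib_left[symmetric] by simp
qed

lemma switching_upd:
  assumes "x j \<le> n"
  shows "switching I x (x(j := n)) = switch_cost I j * (real n - real (x j))"
proof -
  have "switching I x (x(j := n)) =
      (\<Sum>i\<in>UNIV. if i = j then switch_cost I j * (real n - real (x j)) else 0)"
    unfolding switching_def using assms by (intro sum.cong) auto
  then show ?thesis by simp
qed

text \<open>Types can be rounded independently: operating costs are compared type by type for a
  common split, and switching costs are sums over types.\<close>

lemma rounded_schedule_exists:
  assumes I: "valid_instance I" and \<gamma>: "\<gamma> > 1" and X: "is_schedule I X"
  shows "\<exists>Y. (\<forall>t. Y t \<in> grid_configs I \<gamma>) \<and> Y 0 = (\<lambda>_. 0) \<and>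
    schedule_cost I Y \<le> ereal (2 * \<gamma> - 1) * schedule_cost I X"
proof -
  let ?c = "2 * \<gamma> - 1" and ?T = "slots I"
  \<comment> \<open>Setting the count to 0 outside the slots gives the bound by
    \<open>servers\<close> at all times, since a schedule is not constrained beyond
    \<open>slots I + 1\<close>.\<close>
  define a where "a j t = (if t \<in> {1..?T} then X t j else 0)" for j t
  have a_le: "a j t \<le> servers I j" and a0: "a j 0 = 0" for j t
    using X by (auto simp: a_def is_schedule_def)
  have aX: "a j t = X t j" if "t \<in> {0..?T}" for j t
    using X that by (cases "t = 0") (auto simp: a_def is_schedule_def)
  have "\<exists>b. \<forall>j. (\<forall>t. b j t \<in> grid I \<gamma> j \<and> a j t \<le> b j t \<and> real (b j t) \<le> ?c * real (a j t)) \<and>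
    (\<forall>n. (\<Sum>t=1..n. max (real (b j t) - real (b j (t - 1))) 0) \<le>
         ?c * (\<Sum>t=1..n. max (real (a j t) - real (a j (t - 1))) 0))"
    using rounding_exists[OF \<gamma>, of "a j" I j for j] a0 a_le by (intro choice allI) blast
  then obtain b where b: "\<And>j t. b j t \<in> grid I \<gamma> j"
      "\<And>j t. a j t \<le> b j t" "\<And>j t. real (b j t) \<le> ?c * real (a j t)"
    and b_switch: "\<And>j n. (\<Sum>t=1..n. max (real (b j t) - real (b j (t - 1))) 0) \<le>
         ?c * (\<Sum>t=1..n. max (real (a j t) - real (a j (t - 1))) 0)"
    by blast
  define Y where "Y t j = b j t" for t j
  have slot: "slot_cost I t (Y t) \<le> ereal ?c * slot_cost I t (X t)" if t: "t \<in> {1..?T}" for t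
  proof (rule slot_cost_scale[OF I t])
    show "X t j \<le> Y t j" "real (Y t j) \<le> ?c * real (X t j)" for j
      using b(2,3)[where j = j and t = t] aX[of t j] t by (auto simp: Y_def)
  qed (use \<gamma> in simp)
  have "(\<Sum>t=1..?T. switching I (Y (t - 1)) (Y t)) =
      (\<Sum>j\<in>UNIV. switch_cost I j * (\<Sum>t=1..?T. max (real (b j t) - real (b j (t - 1))) 0))"
    unfolding switching_def Y_def by (subst sum.swap) (simp add: sum_distrib_left)
  also have "\<dots> \<le> (\<Sum>j\<in>UNIV. switch_cost I j *
      (?c * (\<Sum>t=1..?T. max (real (a j t) - real (a j (t - 1))) 0)))"
    using valid_instanceD(2)[OF I] by (intro sum_mono mult_left_mono b_switch) (auto intro: less_imp_le)
  also have "\<dots> = ?c * (\<Sum>j\<in>UNIV. \<Sum>t=1..?T. switch_cost I j * max (real (a j t) - real (a j (t - 1))) 0)"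
    by (simp add: sum_distrib_left mult.left_commute)
  also have "\<dots> = ?c * (\<Sum>t=1..?T. switching I (X (t - 1)) (X t))"
    unfolding switching_def
    by (subst sum.swap, intro arg_cong[where f = "(*) ?c"] sum.cong refl)
      (metis aX atLeastAtMost_iff diff_le_self le0 order_trans)
  finally have switch: "(\<Sum>t=1..?T. switching I (Y (t - 1)) (Y t)) \<le>
      ?c * (\<Sum>t=1..?T. switching I (X (t - 1)) (X t))" .
  have "schedule_cost I Y =
      (\<Sum>t=1..?T. slot_cost I t (Y t)) + ereal (\<Sum>t=1..?T. switching I (Y (t - 1)) (Y t))"
    by (simp add: schedule_cost_switching sum.distrib)
  also have "\<dots> \<le> (\<Sum>t=1..?T. ereal ?c * slot_cost I t (X t)) +
      ereal (?c * (\<Sum>t=1..?T. switching I (X (t - 1)) (X t)))"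
    using slot switch by (intro add_mono sum_mono) auto
  also have "\<dots> = ereal ?c * (\<Sum>t=1..?T. slot_cost I t (X t)) +
      ereal ?c * ereal (\<Sum>t=1..?T. switching I (X (t - 1)) (X t))"
    using slot_cost_nonneg[OF I] by (subst sum_ereal_right_distrib) auto
  also have "\<dots> = ereal ?c * ((\<Sum>t=1..?T. slot_cost I t (X t)) +
      ereal (\<Sum>t=1..?T. switching I (X (t - 1)) (X t)))"
    using slot_cost_nonneg[OF I] switching_nonneg[OF I]
    by (intro ereal_right_distrib[symmetric]) (auto intro!: sum_nonneg)
  also have "\<dots> = ereal ?c * schedule_cost I X"
    by (simp add: schedule_cost_switching sum.distrib)
  finally have "schedule_cost I Y \<le> ereal ?c * schedule_cost I X" .
  moreover have "Y 0 = (\<lambda>_. 0)"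
    using b(3)[where t = 0] a0 by (auto simp: Y_def fun_eq_iff)
  moreover have "Y t \<in> grid_configs I \<gamma>" for t
    using b(1) by (simp add: Y_def grid_configs_def)
  ultimately show ?thesis by blast
qed

section \<open>Walks and schedules\<close>

lemma raise_in_grid_configs:
  "x \<in> grid_configs I \<gamma> \<Longrightarrow> x j < servers I j \<Longrightarrow> raise I \<gamma> j x \<in> grid_configs I \<gamma>"
  using next_grid_in_grid by (auto simp: grid_configs_def raise_def)

lemma le_raise: "x j < servers I j \<Longrightarrow> x i \<le> raise I \<gamma> j x i"
  using next_grid_greater[of "x j" I j \<gamma>] by (simp add: raise_def)

lemma switching_raise:
  "x j < servers I j \<Longrightarrow>
    switching I x (raise I \<gamma> j x) = switch_cost I j * (real (next_grid I \<gamma> j (x j)) - real (x j))"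
  unfolding raise_def using next_grid_greater[of "x j" I j \<gamma>] by (intro switching_upd) simp

lemma sched_graph_simps [simp]:
  "tail (sched_graph I \<gamma>) = edge_tail I \<gamma>"
  "head (sched_graph I \<gamma>) = edge_head I \<gamma>"
  "Up t x \<in> verts (sched_graph I \<gamma>) \<longleftrightarrow> t \<in> {1..slots I} \<and> x \<in> grid_configs I \<gamma>"
  "Down t x \<in> verts (sched_graph I \<gamma>) \<longleftrightarrow> t \<in> {1..slots I} \<and> x \<in> grid_configs I \<gamma>"
  "Operate t x \<in> arcs (sched_graph I \<gamma>) \<longleftrightarrow> t \<in> {1..slots I} \<and> x \<in> grid_configs I \<gamma>"
  "Advance t x \<in> arcs (sched_graph I \<gamma>) \<longleftrightarrow> t \<in> {1..slots I - 1} \<and> x \<in> grid_configs I \<gamma>"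
  "PowerUp t x j \<in> arcs (sched_graph I \<gamma>) \<longleftrightarrow>
     t \<in> {1..slots I} \<and> x \<in> grid_configs I \<gamma> \<and> x j < servers I j"
  "PowerDown t x j \<in> arcs (sched_graph I \<gamma>) \<longleftrightarrow>
     t \<in> {1..slots I} \<and> x \<in> grid_configs I \<gamma> \<and> x j < servers I j"
  by (auto simp: sched_graph_def)

lemma wf_sched_graph: "wf_digraph (sched_graph I \<gamma>)"
proof
  fix e assume e: "e \<in> arcs (sched_graph I \<gamma>)"
  show "tail (sched_graph I \<gamma>) e \<in> verts (sched_graph I \<gamma>)"
    using e by (cases e) (auto intro: raise_in_grid_configs)
  show "head (sched_graph I \<gamma>) e \<in> verts (sched_graph I \<gamma>)"
    using e by (cases e) (auto intro: raise_in_grid_configs)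
qed

lemma edge_weight_nonneg:
  assumes I: "valid_instance I" and e: "e \<in> arcs (sched_graph I \<gamma>)"
  shows "0 \<le> edge_weight I \<gamma> e"
proof (cases e)
  case (PowerUp t x j)
  then show ?thesis
    using e switching_raise[of x j I \<gamma>] switching_nonneg[OF I, of x "raise I \<gamma> j x"] by simp
qed (use e slot_cost_nonneg[OF I] in auto)

section \<open>Path weights and removal of cycles\<close>

lemma path_weight_simps [simp]:
  "path_weight I \<gamma> [] = 0"
  "path_weight I \<gamma> (e # p) = edge_weight I \<gamma> e + path_weight I \<gamma> p"
  "path_weight I \<gamma> (p @ q) = path_weight I \<gamma> p + path_weight I \<gamma> q"
  by (auto simp: path_weight_def)

lemma path_weight_nonneg:
  assumes "valid_instance I" and "set p \<subseteq> arcs (sched_graph I \<gamma>)"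
  shows "0 \<le> path_weight I \<gamma> p"
  using assms(2) by (induction p) (auto intro!: add_nonneg_nonneg edge_weight_nonneg[OF assms(1)])

text \<open>Cutting out a cycle cannot increase the weight, as edge weights are nonnegative. This is
  needed because \<open>shortest_path\<close> compares with simple paths only.\<close>

lemma walk_to_path:
  assumes I: "valid_instance I" and p: "pre_digraph.awalk (sched_graph I \<gamma>) u p v"
  shows "\<exists>q. pre_digraph.apath (sched_graph I \<gamma>) u q v \<and> path_weight I \<gamma> q \<le> path_weight I \<gamma> p"
proof -
  interpret wf_digraph "sched_graph I \<gamma>" by (rule wf_sched_graph)
  show ?thesis using p
  proof (induction p rule: length_induct)
    case (1 p)
    show ?case
    proof (cases "distinct (awalk_verts u p)")
      case True
      then show ?thesis using "1.prems" by (auto simp: apath_def)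
    next
      case False
      then obtain q r s where p_eq: "p = q @ r @ s" and r: "0 < length r"
        and w: "\<exists>w. awalk u q w \<and> awalk w r w \<and> awalk w s v"
        using awalk_not_distinct_decomp[OF "1.prems"] by blast
      then have "awalk u (q @ s) v" "length (q @ s) < length p" "set r \<subseteq> arcs (sched_graph I \<gamma>)"
        by (auto simp: awalk_def intro: awalk_appendI)
      then obtain q' where "apath u q' v" "path_weight I \<gamma> q' \<le> path_weight I \<gamma> (q @ s)"
        and r0: "0 \<le> path_weight I \<gamma> r"
        using "1.IH" path_weight_nonneg[OF I] by blast
      moreover have "path_weight I \<gamma> (q @ s) \<le> path_weight I \<gamma> p"
        unfolding p_eq using r0 by (auto intro!: add_left_mono add_increasing)
      ultimately show ?thesis by (meson order_trans)
    qed
  qed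
qed

subsection \<open>From a walk to a schedule\<close>

text \<open>
  The last slot already operated on when a walk is at the given vertex.
\<close>

fun last_slot :: "'d vertex \<Rightarrow> nat" where
  "last_slot (Up t x) = t - 1"
| "last_slot (Down t x) = t"

fun config :: "'d vertex \<Rightarrow> 'd \<Rightarrow> nat" where
  "config (Up t x) = x"
| "config (Down t x) = x"

text \<open>The entry \<open>X s\<close> serves only as the base from which the first switching cost
  is measured. This lets the cost be accumulated backwards along a walk.\<close>

definition cost_after :: "'d::finite dc_instance \<Rightarrow> nat \<Rightarrow> (nat \<Rightarrow> 'd \<Rightarrow> nat) \<Rightarrow> ereal" where
  "cost_after I s X =
     (\<Sum>t=s+1..slots I. slot_cost I t (X t) + ereal (switching I (X (t - 1)) (X t)))"

lemma cost_after_step: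
  assumes "s < slots I"
  shows "cost_after I s X =
    slot_cost I (s + 1) (X (s + 1)) + ereal (switching I (X s) (X (s + 1))) + cost_after I (s + 1) X"
  unfolding cost_after_def using assms by (subst sum.atLeast_Suc_atMost) auto

lemma cost_after_cong:
  assumes "\<And>t. s \<le> t \<Longrightarrow> X t = Y t"
  shows "cost_after I s X = cost_after I s Y"
  unfolding cost_after_def using assms by (intro sum.cong) auto

text \<open>Triangle inequality through the old base \<open>X s\<close>. It accounts for a power-up
  or power-down edge prepended to a walk.\<close>

lemma cost_after_rebase:
  assumes "valid_instance I"
  shows "cost_after I s (X(s := x)) \<le> ereal (switching I x (X s)) + cost_after I s X"
proof (cases "s < slots I")
  case True
  let ?g = "slot_cost I (s + 1) (X (s + 1))" and ?r = "cost_after I (s + 1) X"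
  have "cost_after I (s + 1) (X(s := x)) = ?r"
    by (rule cost_after_cong) auto
  then have "cost_after I s (X(s := x)) = ?g + ereal (switching I x (X (s + 1))) + ?r"
    using cost_after_step[OF True, of "X(s := x)"] by simp
  also have "\<dots> \<le> ?g + ereal (switching I x (X s) + switching I (X s) (X (s + 1))) + ?r"
    using switching_triangle[OF assms] by (intro add_mono) auto
  also have "\<dots> = ereal (switching I x (X s)) + cost_after I s X"
    by (simp add: cost_after_step[OF True] add_ac flip: plus_ereal.simps(1))
  finally show ?thesis .
next
  case False
  then show ?thesis using switching_nonneg[OF assms] by (simp add: cost_after_def)
qed

text \<open>Induction from the end of the walk, with the configuration of the current vertex as base
  of the remaining cost. The equivalence for \<open>Operate\<close> gives existence and uniqueness
  of the operating edge of each slot, so that \<open>THE\<close> in \<open>path_schedule\<close> is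
  meaningful.\<close>

lemma walk_schedule:
  assumes I: "valid_instance I"
    and p: "pre_digraph.awalk (sched_graph I \<gamma>) v p (Down (slots I) (\<lambda>_. 0))"
  shows "\<exists>X. X (last_slot v) = config v \<and>
    (\<forall>t y. Operate t y \<in> set p \<longleftrightarrow> t \<in> {last_slot v + 1..slots I} \<and> y = X t) \<and>
    cost_after I (last_slot v) X \<le> path_weight I \<gamma> p"
proof -
  interpret wf_digraph "sched_graph I \<gamma>" by (rule wf_sched_graph)
  show ?thesis using p
  proof (induction p arbitrary: v)
    case Nil
    then show ?case
      by (intro exI[of _ "\<lambda>_ _. 0"]) (auto simp: awalk_Nil_iff cost_after_def)
  next
    case (Cons e p)
    let ?w = "edge_head I \<gamma> e"
    have e: "e \<in> arcs (sched_graph I \<gamma>)" and v: "v = edge_tail I \<gamma> e"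
      and w: "awalk ?w p (Down (slots I) (\<lambda>_. 0))"
      using Cons.prems by (auto simp: awalk_Cons_iff)
    from Cons.IH[OF w] obtain X where X: "X (last_slot ?w) = config ?w"
      and ops: "\<And>t y. Operate t y \<in> set p \<longleftrightarrow> t \<in> {last_slot ?w + 1..slots I} \<and> y = X t"
      and cost: "cost_after I (last_slot ?w) X \<le> path_weight I \<gamma> p"
      by blast
    show ?case
    proof (cases e)
      case (Operate t x)
      have t: "1 \<le> t" "t \<le> slots I" using e Operate by auto
      \<comment> \<open>The induction hypothesis already gives \<open>X t = x\<close>; with the same
        base in slot \<open>t - 1\<close>, no switching cost arises.\<close>
      let ?X = "X(t - 1 := x)"
      have "cost_after I t ?X = cost_after I t X"
        using t by (intro cost_after_cong) auto
      then have "cost_after I (t - 1) ?X = slot_cost I t x + cost_after I t X"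
        using cost_after_step[of "t - 1" I ?X] t X Operate
        by (simp add: switching_decrease zero_ereal_def[symmetric])
      then have "cost_after I (t - 1) ?X \<le> path_weight I \<gamma> (e # p)"
        using Operate cost by (simp add: add_left_mono)
      moreover have "Operate t' y \<in> set (e # p) \<longleftrightarrow> t' \<in> {t - 1 + 1..slots I} \<and> y = ?X t'" for t' y
        using Operate ops t X by (cases "t' = t") auto
      ultimately show ?thesis
        using Operate v by (intro exI[of _ ?X] conjI allI) (simp_all add: fun_upd_def)
    next
      case (Advance t x)
      then show ?thesis using v X ops cost by (intro exI[of _ X]) auto
    next
      case (PowerUp t x j)
      have t: "1 \<le> t" and lt: "x j < servers I j" using e PowerUp by auto
      let ?X = "X(t - 1 := x)"
      have "cost_after I (t - 1) ?X \<le> ereal (switching I x (X (t - 1))) + cost_after I (t - 1) X"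
        by (rule cost_after_rebase[OF I])
      also have "\<dots> \<le> edge_weight I \<gamma> e + path_weight I \<gamma> p"
        using X cost PowerUp switching_raise[of x j I \<gamma>, OF lt] by (intro add_mono) auto
      finally show ?thesis
        using PowerUp v t X ops by (intro exI[of _ ?X]) (auto simp: fun_upd_def)
    next
      case (PowerDown t x j)
      have lt: "x j < servers I j" using e PowerDown by auto
      let ?X = "X(t := raise I \<gamma> j x)"
      have "cost_after I t ?X \<le> ereal (switching I (raise I \<gamma> j x) (X t)) + cost_after I t X"
        by (rule cost_after_rebase[OF I])
      also have "\<dots> \<le> edge_weight I \<gamma> e + path_weight I \<gamma> p"
        using X cost PowerDown switching_decrease[of x "raise I \<gamma> j x" I] le_raise[of x j I _ \<gamma>, OF lt]
        by (intro add_mono) auto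
      finally show ?thesis
        using PowerDown v X ops by (intro exI[of _ ?X]) (auto simp: fun_upd_def)
    qed
  qed
qed

text \<open>Equality can fail: a walk may power servers down after one slot and pay to power them up
  again before the next.\<close>

lemma path_schedule_cost_le:
  assumes I: "valid_instance I"
    and p: "pre_digraph.awalk (sched_graph I \<gamma>) (Up 1 (\<lambda>_. 0)) p (Down (slots I) (\<lambda>_. 0))"
  shows "schedule_cost I (path_schedule I p) \<le> path_weight I \<gamma> p"
proof -
  obtain X where X0: "X 0 = (\<lambda>_. 0)"
    and ops: "\<And>t y. Operate t y \<in> set p \<longleftrightarrow> t \<in> {1..slots I} \<and> y = X t"
    and cost: "cost_after I 0 X \<le> path_weight I \<gamma> p"
    using walk_schedule[OF I p] by auto
  have eq: "path_schedule I p t = X t" if "t \<in> {0..slots I}" for t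
    using that X0 by (cases "t = 0") (auto simp: path_schedule_def ops)
  have "schedule_cost I (path_schedule I p) = cost_after I 0 X"
    unfolding schedule_cost_switching cost_after_def by (intro sum.cong) (auto simp: eq)
  then show ?thesis using cost by simp
qed

subsection \<open>From a schedule to a walk\<close>

definition walk_within ::
    "'d::finite dc_instance \<Rightarrow> real \<Rightarrow> 'd vertex \<Rightarrow> 'd vertex \<Rightarrow> ereal \<Rightarrow> bool" where
  "walk_within I \<gamma> u v w \<longleftrightarrow>
     (\<exists>p. pre_digraph.awalk (sched_graph I \<gamma>) u p v \<and> path_weight I \<gamma> p \<le> w)"

lemma walk_within_refl:
  assumes "v \<in> verts (sched_graph I \<gamma>)"
  shows "walk_within I \<gamma> v v 0"
proof -
  interpret wf_digraph "sched_graph I \<gamma>" by (rule wf_sched_graph)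
  show ?thesis unfolding walk_within_def
    using assms by (intro exI[of _ "[]"]) (simp add: awalk_Nil_iff)
qed

lemma walk_within_trans:
  assumes "walk_within I \<gamma> u v a" and "walk_within I \<gamma> v w b"
  shows "walk_within I \<gamma> u w (a + b)"
proof -
  interpret wf_digraph "sched_graph I \<gamma>" by (rule wf_sched_graph)
  from assms obtain p q where "awalk u p v" "awalk v q w"
    and "path_weight I \<gamma> p \<le> a" "path_weight I \<gamma> q \<le> b"
    unfolding walk_within_def by blast
  then show ?thesis unfolding walk_within_def
    by (intro exI[of _ "p @ q"]) (auto intro: add_mono awalk_appendI)
qed

lemma walk_within_edge:
  assumes "e \<in> arcs (sched_graph I \<gamma>)"
  shows "walk_within I \<gamma> (edge_tail I \<gamma> e) (edge_head I \<gamma> e) (edge_weight I \<gamma> e)"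
proof -
  interpret wf_digraph "sched_graph I \<gamma>" by (rule wf_sched_graph)
  show ?thesis unfolding walk_within_def
    using arc_implies_awalk[OF assms] by (intro exI[of _ "[e]"]) auto
qed

text \<open>Induction on the total distance from \<open>x\<close> to \<open>y\<close>. A raise never
  overshoots, since \<open>y j\<close> is itself a grid point above \<open>x j\<close>.\<close>

lemma grid_config_induct [consumes 3, case_names refl raise]:
  assumes "x \<in> grid_configs I \<gamma>" and "y \<in> grid_configs I \<gamma>" and "\<And>j. x j \<le> y j"
    and refl: "P y"
    and raise: "\<And>x j. x \<in> grid_configs I \<gamma> \<Longrightarrow> x j < servers I j \<Longrightarrow>
      raise I \<gamma> j x \<in> grid_configs I \<gamma> \<Longrightarrow> (\<And>i. raise I \<gamma> j x i \<le> y i) \<Longrightarrow>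
      P (raise I \<gamma> j x) \<Longrightarrow> P x"
  shows "P x"
  using assms(1,3)
proof (induction "\<Sum>j\<in>UNIV. y j - x j" arbitrary: x rule: less_induct)
  case less
  show ?case
  proof (cases "x = y")
    case True
    then show ?thesis using refl by simp
  next
    case False
    then obtain j where "x j \<noteq> y j" by auto
    with less.prems(2)[of j] have j: "x j < y j" by simp
    moreover have y: "y j \<in> grid I \<gamma> j" using assms(2) by (simp add: grid_configs_def)
    ultimately have lt: "x j < servers I j" using grid_le_servers by (meson less_le_trans)
    have le: "raise I \<gamma> j x i \<le> y i" for i
      using less.prems(2) next_grid_least[OF lt y j] by (simp add: raise_def)
    have "(\<Sum>i\<in>UNIV. y i - raise I \<gamma> j x i) < (\<Sum>i\<in>UNIV. y i - x i)"
    proof (rule sum_strict_mono_ex1)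
      show "\<forall>i\<in>UNIV. y i - raise I \<gamma> j x i \<le> y i - x i"
        using le_raise[of x j I _ \<gamma>, OF lt] by (simp add: diff_le_mono2)
      show "\<exists>i\<in>UNIV. y i - raise I \<gamma> j x i < y i - x i"
        using j next_grid_greater[OF lt, of \<gamma>] by (intro bexI[of _ j]) (auto simp: raise_def)
    qed simp
    moreover have "raise I \<gamma> j x \<in> grid_configs I \<gamma>"
      by (rule raise_in_grid_configs[of x I \<gamma> j, OF less.prems(1) lt])
    ultimately show ?thesis
      using less.hyps[of "raise I \<gamma> j x"] le raise[of x j] less.prems(1) lt by blast
  qed
qed

text \<open>The edge weights add up to the direct switching cost because \<open>switching\<close> is
  additive along increasing chains.\<close>

lemma walk_within_power_up:
  assumes t: "t \<in> {1..slots I}"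
    and "x \<in> grid_configs I \<gamma>" and y: "y \<in> grid_configs I \<gamma>" and "\<And>j. x j \<le> y j"
  shows "walk_within I \<gamma> (Up t x) (Up t y) (ereal (switching I x y))"
  using assms(2-)
proof (induction rule: grid_config_induct)
  case refl
  then show ?case
    using walk_within_refl[of "Up t y" I \<gamma>] t y by (simp add: switching_decrease zero_ereal_def)
next
  case (raise x j)
  have "walk_within I \<gamma> (Up t x) (Up t (raise I \<gamma> j x)) (ereal (switching I x (raise I \<gamma> j x)))"
    using walk_within_edge[of "PowerUp t x j" I \<gamma>] raise t switching_raise[of x j I \<gamma>] by simp
  from walk_within_trans[OF this raise.IH] show ?case
    using switching_add[of x "raise I \<gamma> j x" y I] raise le_raise[of x j I _ \<gamma>] by simp
qed

lemma walk_within_power_down: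
  assumes t: "t \<in> {1..slots I}"
    and "x \<in> grid_configs I \<gamma>" and y: "y \<in> grid_configs I \<gamma>" and "\<And>j. x j \<le> y j"
  shows "walk_within I \<gamma> (Down t y) (Down t x) 0"
  using assms(2-)
proof (induction rule: grid_config_induct)
  case refl
  then show ?case using walk_within_refl[of "Down t y" I \<gamma>] t y by simp
next
  case (raise x j)
  have "walk_within I \<gamma> (Down t (raise I \<gamma> j x)) (Down t x) 0"
    using walk_within_edge[of "PowerDown t x j" I \<gamma>] raise t by simp
  from walk_within_trans[OF raise.IH this] show ?case by simp
qed

lemma walk_within_operate:
  assumes "t \<in> {1..slots I}" and "x \<in> grid_configs I \<gamma>" and "y \<in> grid_configs I \<gamma>"
    and "\<And>j. x j \<le> y j"
  shows "walk_within I \<gamma> (Up t x) (Down t y) (slot_cost I t y + ereal (switching I x y))"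
  using walk_within_trans[OF walk_within_power_up[OF assms], of "Down t y" "slot_cost I t y"]
    walk_within_edge[of "Operate t y" I \<gamma>] assms by (simp add: add.commute)

lemma zero_in_grid_configs: "(\<lambda>_. 0) \<in> grid_configs I \<gamma>"
  by (simp add: grid_configs_def zero_in_grid)

lemma schedule_walk:
  assumes Y: "\<And>t. Y t \<in> grid_configs I \<gamma>" and Y0: "Y 0 = (\<lambda>_. 0)" and T: "slots I \<ge> 1"
  shows "walk_within I \<gamma> (Up 1 (\<lambda>_. 0)) (Down (slots I) (\<lambda>_. 0)) (schedule_cost I Y)"
proof -
  have "walk_within I \<gamma> (Up 1 (\<lambda>_. 0)) (Down n (Y n))
      (\<Sum>t=1..n. slot_cost I t (Y t) + ereal (switching I (Y (t - 1)) (Y t)))"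
    if "1 \<le> n" "n \<le> slots I" for n
    using that
  proof (induction n rule: nat_induct_at_least)
    case base
    then show ?case
      using walk_within_operate[of 1 I "Y 0" \<gamma> "Y 1"] Y[of 0] Y[of 1] Y0 by simp
  next
    case (Suc n)
    \<comment> \<open>Between slots the walk descends for free to the componentwise minimum, which
      is again on the grid, and then pays exactly for the increases.\<close>
    let ?m = "\<lambda>j. min (Y n j) (Y (Suc n) j)"
    have m: "?m \<in> grid_configs I \<gamma>"
      using Y[of n] Y[of "Suc n"] by (auto simp: grid_configs_def min_def)
    have down: "walk_within I \<gamma> (Down n (Y n)) (Down n ?m) 0"
      using Suc m Y by (intro walk_within_power_down) auto
    have advance: "walk_within I \<gamma> (Down n ?m) (Up (Suc n) ?m) 0"
      using walk_within_edge[of "Advance n ?m" I \<gamma>] Suc m by simp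
    have up: "walk_within I \<gamma> (Up (Suc n) ?m) (Down (Suc n) (Y (Suc n)))
        (slot_cost I (Suc n) (Y (Suc n)) + ereal (switching I ?m (Y (Suc n))))"
      using Suc m Y by (intro walk_within_operate) auto
    have "switching I ?m (Y (Suc n)) = switching I (Y n) (Y (Suc n))"
      unfolding switching_def by (intro sum.cong) auto
    then have "walk_within I \<gamma> (Down n (Y n)) (Down (Suc n) (Y (Suc n)))
        (slot_cost I (Suc n) (Y (Suc n)) + ereal (switching I (Y n) (Y (Suc n))))"
      using walk_within_trans[OF down walk_within_trans[OF advance up]] by simp
    with Suc show ?case
      using walk_within_trans by fastforce
  qed
  from this[OF T order_refl] have "walk_within I \<gamma> (Up 1 (\<lambda>_. 0)) (Down (slots I) (Y (slots I)))
      (schedule_cost I Y)"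
    by (simp add: schedule_cost_switching)
  moreover have "walk_within I \<gamma> (Down (slots I) (Y (slots I))) (Down (slots I) (\<lambda>_. 0)) 0"
    using T Y zero_in_grid_configs by (intro walk_within_power_down) auto
  ultimately show ?thesis
    using walk_within_trans by fastforce
qed

theorem theorem16:
  fixes I :: "'d::finite dc_instance"
    and \<gamma> :: real
    and P :: "'d edge list"
    and X_opt :: "nat \<Rightarrow> 'd \<Rightarrow> nat"
  assumes "valid_instance I"
    and "\<gamma> > 1"
    and "shortest_path I \<gamma> (Up 1 (\<lambda>_. 0)) P (Down (slots I) (\<lambda>_. 0))"
    and "optimal I X_opt"
  shows "schedule_cost I (path_schedule I P) \<le> ereal (2 * \<gamma> - 1) * schedule_cost I X_opt"
proof -
  let ?u = "Up 1 (\<lambda>_. 0)" and ?v = "Down (slots I) (\<lambda>_. 0)"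
  have "is_schedule I X_opt"
    using assms(4) by (simp add: optimal_def feasible_def)
  from rounded_schedule_exists[OF assms(1,2) this] obtain Y
    where Y: "\<And>t. Y t \<in> grid_configs I \<gamma>" "Y 0 = (\<lambda>_. 0)"
      and cost: "schedule_cost I Y \<le> ereal (2 * \<gamma> - 1) * schedule_cost I X_opt"
    by blast
  from schedule_walk[of Y, OF Y valid_instanceD(1)[OF assms(1)]] obtain q
    where q: "pre_digraph.awalk (sched_graph I \<gamma>) ?u q ?v" "path_weight I \<gamma> q \<le> schedule_cost I Y"
    unfolding walk_within_def by blast
  \<comment> \<open>The constructed walk \<open>q\<close> is replaced by a simple path, to which the
    minimality of \<open>P\<close> applies.\<close>
  obtain r where r: "pre_digraph.apath (sched_graph I \<gamma>) ?u r ?v"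
    "path_weight I \<gamma> r \<le> path_weight I \<gamma> q"
    using walk_to_path[OF assms(1) q(1)] by blast
  have P: "pre_digraph.awalk (sched_graph I \<gamma>) ?u P ?v"
    using assms(3) by (simp add: shortest_path_def pre_digraph.apath_def)
  have "schedule_cost I (path_schedule I P) \<le> path_weight I \<gamma> P"
    by (rule path_schedule_cost_le[OF assms(1) P])
  also have "\<dots> \<le> path_weight I \<gamma> r"
    using assms(3) r(1) by (simp add: shortest_path_def)
  also note r(2)
  also note q(2)
  also note cost
  finally show ?thesis .
qed

end
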